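(* Let $k,l$ be integers with either (i) $k\ge 4$ and $l\ge 3$, or (ii) $k=3$ and $l\ge 2074$. Then the graph $\overline{T_{n,l-1}}$ is not optimal for the $(k,l)$-problem: there is $N$ such that for every $n\ge N$ there exists an $n$-vertex graph $G$ with $\alpha(G)<l$ and $t_k(G)<t_k(\overline{T_{n,l-1}})$; that is, $f(n,k,l)<t_k(\overline{T_{n,l-1}})$.
   Context: For a graph $G$, $\alpha(G)$ is its independence number and $t_k(G)$ is the number of $k$-cliques in $G$. $f(n,k,l)$ is the minimum of $t_k(G)$ over $n$-vertex graphs $G$ with $\alpha(G)<l$ (the "$(k,l)$-problem"). $\overline{T_{n,l-1}}$ denotes the complement of the Turán graph, i.e. the disjoint union of $l-1$ cliques on $n$ vertices in total whose sizes are as equal as possible; it has $\alpha=l-1$. *)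

theory Defs
  imports Complex_Main "HOL-Library.Ramsey"
begin

text \<open>
  A finite simple graph is a finite vertex set together with a set of two-element subsets of it;
  cliques and independent sets are the predicates of the Ramsey theory of the library.
\<close>

definition fin_sgraph :: "'a set \<Rightarrow> 'a set set \<Rightarrow> bool" where
  "fin_sgraph V E \<longleftrightarrow> finite V \<and> E \<subseteq> [V]\<^bsup>2\<^esup>"

definition independence_number :: "'a set \<Rightarrow> 'a set set \<Rightarrow> nat" where
  "independence_number V E = Max {card S | S. S \<subseteq> V \<and> indep S E}"

definition num_cliques :: "nat \<Rightarrow> 'a set \<Rightarrow> 'a set set \<Rightarrow> nat" where
  "num_cliques k V E = card {S. S \<subseteq> V \<and> card S = k \<and> clique S E}"

definition admissible :: "nat \<Rightarrow> nat \<Rightarrow> nat set \<Rightarrow> nat set set \<Rightarrow> bool" where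
  "admissible n l V E \<longleftrightarrow> fin_sgraph V E \<and> card V = n \<and> independence_number V E < l"

text \<open>
  Vertices are natural numbers, which covers every finite graph up to isomorphism. The infimum of
  a nonempty set of natural numbers is its minimum; see \<open>min_cliques_attained\<close> below.
\<close>

definition min_cliques :: "nat \<Rightarrow> nat \<Rightarrow> nat \<Rightarrow> nat" where
  "min_cliques n k l = Inf {num_cliques k V E | V E. admissible n l V E}"

definition complement_edges :: "'a set \<Rightarrow> 'a set set \<Rightarrow> 'a set set" where
  "complement_edges V E = [V]\<^bsup>2\<^esup> - E"

text \<open>
  The Turan graph with \<open>r\<close> parts on the vertices \<open>0, \<dots>, n - 1\<close>: the parts are the residue classes
  modulo \<open>r\<close>, whose sizes differ by at most one.
\<close>

definition turan_edges :: "nat \<Rightarrow> nat \<Rightarrow> nat set set" where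
  "turan_edges n r = {{i, j} | i j. i < n \<and> j < n \<and> i mod r \<noteq> j mod r}"

definition co_turan_edges :: "nat \<Rightarrow> nat \<Rightarrow> nat set set" where
  "co_turan_edges n r = complement_edges {..<n} (turan_edges n r)"


lemma turan_part_card:
  fixes n r c :: nat
  assumes "c < r"
  shows "card {i. i < n \<and> i mod r = c} = (if c < n mod r then n div r + 1 else n div r)"
proof -
  define m where "m = (if c < n mod r then n div r + 1 else n div r)"
  have nn: "n = n div r * r + n mod r" by simp
  have lt: "n mod r < r" using assms by simp
  have "q * r + c < n \<longleftrightarrow> q < m" for q
  proof
    assume q: "q * r + c < n"
    show "q < m"
    proof (rule ccontr)
      assume "\<not> q < m"
      then have "m * r \<le> q * r" by simp
      then have le: "m * r + c < n" using q by linarith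
      show False
      proof (cases "c < n mod r")
        case True
        then have "m * r = n div r * r + r" by (simp add: m_def)
        then show False using le nn lt by linarith
      next
        case False
        then have "m * r = n div r * r" by (simp add: m_def)
        then show False using le nn False by linarith
      qed
    qed
  next
    assume "q < m"
    then have "q < n div r \<or> (q = n div r \<and> c < n mod r)"
      by (auto simp: m_def split: if_splits)
    then show "q * r + c < n"
    proof
      assume "q < n div r"
      then have "Suc q * r \<le> n div r * r" by (intro mult_le_mono1) simp
      then show ?thesis using nn assms mult_Suc[of q r] by linarith
    next
      assume q: "q = n div r \<and> c < n mod r"
      then have "q * r = n div r * r" by simp
      then show ?thesis using nn q by linarith
    qed
  qed
  note iff = this
  have "{i. i < n \<and> i mod r = c} = (\<lambda>q. q * r + c) ` {..<m}"
  proof (intro equalityI subsetI)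
    fix i assume "i \<in> {i. i < n \<and> i mod r = c}"
    then have i: "i < n" "i = (i div r) * r + c" by auto
    then have "(i div r) * r + c < n" by simp
    then have "i div r < m" using iff by blast
    then show "i \<in> (\<lambda>q. q * r + c) ` {..<m}" using i(2) by blast
  next
    fix i assume "i \<in> (\<lambda>q. q * r + c) ` {..<m}"
    then show "i \<in> {i. i < n \<and> i mod r = c}" using iff assms by fastforce
  qed
  moreover have "inj_on (\<lambda>q. q * r + c) {..<m}" using assms by (auto simp: inj_on_def)
  ultimately show ?thesis by (simp add: card_image m_def)
qed

lemma doubleton_in_co_turan_edges:
  "{i, j} \<in> co_turan_edges n r \<longleftrightarrow> i < n \<and> j < n \<and> i \<noteq> j \<and> i mod r = j mod r"
  unfolding co_turan_edges_def complement_edges_def turan_edges_def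
  by (auto simp: doubleton_eq_iff)

lemma fin_sgraph_co_turan: "fin_sgraph {..<n} (co_turan_edges n r)"
  by (auto simp: fin_sgraph_def co_turan_edges_def complement_edges_def)

lemma independence_number_co_turan:
  assumes "0 < r" "r \<le> n"
  shows "independence_number {..<n} (co_turan_edges n r) = r"
  unfolding independence_number_def
proof (rule Max_eqI)
  have "{card S | S. S \<subseteq> {..<n} \<and> indep S (co_turan_edges n r)} \<subseteq> card ` Pow {..<n}" by auto
  then show "finite {card S | S. S \<subseteq> {..<n} \<and> indep S (co_turan_edges n r)}"
    by (rule finite_subset) simp
next
  fix y assume "y \<in> {card S | S. S \<subseteq> {..<n} \<and> indep S (co_turan_edges n r)}"
  then obtain S where S: "y = card S" "S \<subseteq> {..<n}" "indep S (co_turan_edges n r)" by auto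
  have "inj_on (\<lambda>i. i mod r) S"
    using S(2,3) unfolding inj_on_def indep_def doubleton_in_co_turan_edges by blast
  moreover have "(\<lambda>i. i mod r) ` S \<subseteq> {..<r}" using assms by auto
  ultimately show "y \<le> r" using S(1) card_inj_on_le[of _ S "{..<r}"] by simp
next
  have "indep {..<r} (co_turan_edges n r)"
    by (auto simp: indep_def doubleton_in_co_turan_edges)
  moreover have "{..<r} \<subseteq> {..<n}" "card {..<r} = r" using assms by auto
  ultimately show "r \<in> {card S | S. S \<subseteq> {..<n} \<and> indep S (co_turan_edges n r)}"
    by force
qed

lemma min_cliques_attained:
  assumes "2 \<le> l"
  shows "\<exists>V E. admissible n l V E \<and> num_cliques k V E = min_cliques n k l"
proof -
  have "independence_number {..<n} ([{..<n}]\<^bsup>2\<^esup>) \<le> 1"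
    unfolding independence_number_def
  proof (rule Max.boundedI)
    have "{card S | S. S \<subseteq> {..<n} \<and> indep S ([{..<n}]\<^bsup>2\<^esup>)} \<subseteq> card ` Pow {..<n}" by auto
    then show "finite {card S | S. S \<subseteq> {..<n} \<and> indep S ([{..<n}]\<^bsup>2\<^esup>)}"
      by (rule finite_subset) simp
    show "{card S | S. S \<subseteq> {..<n} \<and> indep S ([{..<n}]\<^bsup>2\<^esup>)} \<noteq> {}"
      by (auto simp: indep_def)
  next
    fix y assume "y \<in> {card S | S. S \<subseteq> {..<n} \<and> indep S ([{..<n}]\<^bsup>2\<^esup>)}"
    then obtain S where S: "y = card S" "S \<subseteq> {..<n}" "indep S ([{..<n}]\<^bsup>2\<^esup>)" by auto
    have "finite S" using S(2) finite_subset by blast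
    moreover have "a = b" if "a \<in> S" "b \<in> S" for a b
      using S(2,3) that by (auto simp: indep_def)
    ultimately show "y \<le> 1" using S(1) by (simp add: card_le_Suc0_iff_eq)
  qed
  then have "admissible n l {..<n} ([{..<n}]\<^bsup>2\<^esup>)"
    using assms by (simp add: admissible_def fin_sgraph_def)
  then have "{num_cliques k V E | V E. admissible n l V E} \<noteq> {}" by blast
  then have "min_cliques n k l \<in> {num_cliques k V E | V E. admissible n l V E}"
    unfolding min_cliques_def by (rule Inf_nat_def1)
  then obtain V E where "min_cliques n k l = num_cliques k V E" "admissible n l V E" by blast
  then show ?thesis by metis
qed

end

theory Submission
  imports Defs "HOL-Combinatorics.Multiset_Permutations"
begin

text \<open>
  Replace \<open>s\<close> of the \<open>l - 1\<close> cliques by a balanced clique blow-up of a fixed pattern graph on \<open>m\<close>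
  vertices with independence number at most \<open>s\<close>. This does not raise the independence number beyond
  \<open>l - 1\<close>. If \<open>w\<close> counts the ordered \<open>k\<close>-tuples of pattern vertices, repetitions allowed, whose entries
  are pairwise equal or adjacent, the blow-up on \<open>M\<close> vertices has about \<open>w (M / m)\<^sup>k / k!\<close> cliques of
  size \<open>k\<close>, compared with \<open>s (M / s)\<^sup>k / k!\<close> before. So it wins for large \<open>n\<close> as soon as
  \<open>w s\<^bsup>k-1\<^esup> < m\<^sup>k\<close>.

  For \<open>k \<ge> 4\<close> the pentagon works, with \<open>s = 2\<close> and \<open>w = 5 (2\<^sup>k - 1)\<close>. For \<open>k = 3\<close> take \<open>s = 2073\<close> and a
  random graph on \<open>m = 79 \<cdot> 2074\<close> vertices with edge probability \<open>p = 0.005165\<close>: the expectation of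
  \<open>w s\<^sup>2 / m\<^sup>3\<close> plus the expected number of independent 2074-sets is below 1.
\<close>

section \<open>Blow-ups of a pattern graph\<close>

text \<open>These are the homomorphisms from the complete graph on \<open>k\<close> vertices to the
  pattern with a loop added at every vertex. Loops are right because each blow-up class is itself a
  clique.\<close>

definition closed_tuples :: "nat \<Rightarrow> nat \<Rightarrow> (nat \<Rightarrow> nat \<Rightarrow> bool) \<Rightarrow> nat list set" where
  "closed_tuples k m R =
     {xs. length xs = k \<and> set xs \<subseteq> {..<m} \<and> (\<forall>a\<in>set xs. \<forall>b\<in>set xs. a = b \<or> R a b)}"

lemma finite_closed_tuples: "finite (closed_tuples k m R)"
  by (rule finite_subset[of _ "{xs. set xs \<subseteq> {..<m} \<and> length xs = k}"])
    (auto simp: closed_tuples_def finite_lists_length_eq)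

section \<open>Counting cliques of a blow-up through ordered tuples\<close>

text \<open>Each entry of \<open>xs\<close> is chosen independently in the fibre of the matching
  entry of \<open>ys\<close>, with at most \<open>b\<close> choices. Finiteness is proved along with
  the bound because the induction step needs it.\<close>

lemma card_map_fibre_le:
  assumes "finite A" "\<And>a. card {x \<in> A. \<phi> x = a} \<le> b"
  shows "finite {xs. set xs \<subseteq> A \<and> map \<phi> xs = ys} \<and>
    card {xs. set xs \<subseteq> A \<and> map \<phi> xs = ys} \<le> b ^ length ys"
proof (induction ys)
  case Nil
  have "{xs. set xs \<subseteq> A \<and> map \<phi> xs = []} = {[]}" by auto
  then show ?case by simp
next
  case (Cons y ys)
  let ?X = "{x \<in> A. \<phi> x = y}" and ?L = "{xs. set xs \<subseteq> A \<and> map \<phi> xs = ys}"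
  have eq: "{xs. set xs \<subseteq> A \<and> map \<phi> xs = y # ys} = (\<lambda>(x, xs). x # xs) ` (?X \<times> ?L)"
    by (auto simp: map_eq_Cons_conv)
  have fin: "finite (?X \<times> ?L)" using assms(1) Cons by simp
  have "card ((\<lambda>(x, xs). x # xs) ` (?X \<times> ?L)) \<le> card ?X * card ?L"
    using card_image_le[OF fin] by (metis card_cartesian_product)
  also have "\<dots> \<le> b * b ^ length ys" using assms(2) Cons by (intro mult_mono) auto
  finally show ?case using fin by (simp add: eq)
qed

text \<open>Double counting: a set in \<open>K\<close> has \<open>fact k\<close> orderings, each is
  sent by \<open>map \<phi>\<close> to a closed tuple, and every closed tuple is hit at most
  \<open>b ^ k\<close> times.\<close>

lemma card_sets_le_closed_tuples:
  assumes fin: "finite A" and fib: "\<And>a. card {x \<in> A. \<phi> x = a} \<le> b"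
    and K: "\<And>S. S \<in> K \<Longrightarrow> S \<subseteq> A \<and> card S = k \<and> (\<forall>x\<in>S. \<forall>y\<in>S. \<phi> x = \<phi> y \<or> R (\<phi> x) (\<phi> y))"
    and range: "\<phi> ` A \<subseteq> {..<m}"
  shows "card K * fact k \<le> card (closed_tuples k m R) * b ^ k"
proof -
  have Ksub: "K \<subseteq> Pow A" using K by blast
  have finK: "finite K" using fin Ksub finite_subset by blast
  have finS: "finite S" if "S \<in> K" for S using K[OF that] fin finite_subset by blast
  have "card (\<Union>S\<in>K. permutations_of_set S) = (\<Sum>S\<in>K. card (permutations_of_set S))"
    by (rule card_UN_disjoint) (auto simp: finK dest: permutations_of_setD)
  also have "\<dots> = (\<Sum>S\<in>K. fact k)"
    using K finS by (intro sum.cong) auto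
  finally have "card K * fact k = card (\<Union>S\<in>K. permutations_of_set S)" by simp
  also have "\<dots> \<le> card (\<Union>ys\<in>closed_tuples k m R. {xs. set xs \<subseteq> A \<and> map \<phi> xs = ys})"
  proof (rule card_mono)
    show "finite (\<Union>ys\<in>closed_tuples k m R. {xs. set xs \<subseteq> A \<and> map \<phi> xs = ys})"
      using card_map_fibre_le[OF fin fib] finite_closed_tuples by blast
    show "(\<Union>S\<in>K. permutations_of_set S)
      \<subseteq> (\<Union>ys\<in>closed_tuples k m R. {xs. set xs \<subseteq> A \<and> map \<phi> xs = ys})"
    proof
      fix xs assume "xs \<in> (\<Union>S\<in>K. permutations_of_set S)"
      then obtain S where S: "S \<in> K" "set xs = S" "distinct xs"
        by (auto simp: permutations_of_set_def)
      have "length xs = k" using S K[OF S(1)] distinct_card by fastforce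
      then have "map \<phi> xs \<in> closed_tuples k m R"
        using S K[OF S(1)] range by (auto simp: closed_tuples_def)
      then show "xs \<in> (\<Union>ys\<in>closed_tuples k m R. {xs. set xs \<subseteq> A \<and> map \<phi> xs = ys})"
        using S K[OF S(1)] by auto
    qed
  qed
  also have "\<dots> \<le> (\<Sum>ys\<in>closed_tuples k m R. card {xs. set xs \<subseteq> A \<and> map \<phi> xs = ys})"
    by (rule card_UN_le[OF finite_closed_tuples])
  also have "\<dots> \<le> (\<Sum>ys\<in>closed_tuples k m R. b ^ k)"
    using card_map_fibre_le[OF fin fib] by (intro sum_mono) (fastforce simp: closed_tuples_def)
  finally show ?thesis by simp
qed

section \<open>Comparing the two clique counts for large class size\<close>

lemma diff_times_binomial: "(q - k) * (q choose k) = Suc k * (q choose Suc k)" for q k :: nat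
proof (cases q)
  case (Suc q')
  then show ?thesis
    using binomial_absorb_comp[of q k] Suc_times_binomial[of k q'] by simp
qed simp

text \<open>The right side is the falling factorial q (q - 1) ... (q - k + 1), all of whose factors
  are at least q - k. For q < k truncated subtraction keeps the bound true.\<close>

lemma power_diff_le_fact_binomial: "(q - k) ^ k \<le> fact k * (q choose k)" for q k :: nat
proof (induction k)
  case (Suc k)
  have "(q - Suc k) ^ Suc k \<le> (q - k) * (q - k) ^ k"
    using power_mono[of "q - Suc k" "q - k" "Suc k"] by simp
  also have "\<dots> \<le> (q - k) * (fact k * (q choose k))" using Suc by simp
  also have "\<dots> = fact k * ((q - k) * (q choose k))" by (simp add: mult.left_commute)
  also have "(q - k) * (q choose k) = Suc k * (q choose Suc k)"
    by (rule diff_times_binomial)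
  finally show ?case by (simp add: algebra_simps)
qed simp

text \<open>After division by q^k the left side tends to w (r/m)^k and the right side to r, and the
  hypothesis multiplied by r says w r^k < r m^k. Here \<open>r\<close> is the number of cliques
  being replaced, \<open>q\<close> their approximate size, and the base on the left bounds the size
  of a blow-up class.\<close>

lemma eventually_blowup_inequality:
  fixes w r m k :: nat
  assumes "0 < m" "0 < r" "1 \<le> k" "w * r ^ (k - 1) < m ^ k"
  shows "\<forall>\<^sub>F q in sequentially. w * ((q + 1) * r div m + 1) ^ k < r * (q - k) ^ k"
proof -
  \<comment> \<open>The numerator bounds \<open>m\<close> times the class size, with the rounding of
    \<open>div\<close> absorbed by the summand \<open>m\<close>; the quotient tends to
    \<open>r\<close>.\<close>
  define f where "f q = ((real q + 1) * r + m) / (real q - k)" for q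
  have "(\<lambda>q. (r + (real r + m) / real q) / (1 - k / real q)) \<longlonglongrightarrow> (real r + 0) / (1 - 0)"
    by (intro tendsto_divide tendsto_add tendsto_diff tendsto_const lim_const_over_n) simp_all
  moreover have "\<forall>\<^sub>F q in sequentially. (r + (real r + m) / real q) / (1 - k / real q) = f q"
    using eventually_gt_at_top[of k]
  proof eventually_elim
    case (elim q)
    then have "real q > 0" "real q - k > 0" by auto
    then show ?case unfolding f_def by (simp add: field_simps)
  qed
  ultimately have "f \<longlonglongrightarrow> r" by (simp add: tendsto_cong)
  then have lim: "(\<lambda>q. w * f q ^ k) \<longlonglongrightarrow> w * real r ^ k" by (intro tendsto_intros)
  have "w * r ^ k = r * (w * r ^ (k - 1))" using assms(3) by (cases k) auto
  then have "w * r ^ k < r * m ^ k" using assms(2,4) by (metis mult_less_mono2)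
  then have "w * real r ^ k < real r * m ^ k" by (metis of_nat_less_iff of_nat_mult of_nat_power)
  from order_tendstoD(2)[OF lim this]
  have "\<forall>\<^sub>F q in sequentially. w * f q ^ k < real r * m ^ k" by simp
  then show ?thesis using eventually_gt_at_top[of k]
  proof eventually_elim
    case (elim q)
    define d where "d = (q + 1) * r div m + 1"
    have pos: "real q - k > 0" using elim by simp
    have "real d * m \<le> (real q + 1) * r + m"
    proof -
      have "(q + 1) * r div m * m \<le> (q + 1) * r" by simp
      then have "d * m \<le> (q + 1) * r + m" unfolding d_def by (simp add: algebra_simps)
      then have "real (d * m) \<le> real ((q + 1) * r + m)" by (rule of_nat_mono)
      then show ?thesis by (simp add: algebra_simps)
    qed
    also have "\<dots> = f q * (real q - k)" using pos by (simp add: f_def)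
    finally have "(real d * m) ^ k \<le> (f q * (real q - k)) ^ k" by (intro power_mono) auto
    then have "w * (real d * m) ^ k \<le> (w * f q ^ k) * (real q - k) ^ k"
      using mult_left_mono[of _ _ "real w"] by (simp add: power_mult_distrib mult.assoc)
    also have "\<dots> < (real r * m ^ k) * (real q - k) ^ k"
      using elim pos by (intro mult_strict_right_mono) auto
    finally have "(w * real d ^ k) * m ^ k < (real r * (real q - k) ^ k) * m ^ k"
      by (simp add: power_mult_distrib algebra_simps)
    then have "w * real d ^ k < real r * (real q - k) ^ k"
      using assms(1) by (simp add: mult_less_cancel_right)
    also have "real q - k = real (q - k)" using elim by simp
    finally have "real (w * d ^ k) < real (r * (q - k) ^ k)" by simp
    then show ?case unfolding d_def of_nat_less_iff .
  qed
qed

section \<open>The blow-up construction and its clique count\<close>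

lemma independence_number_leI:
  assumes "finite V" "\<And>S. S \<subseteq> V \<Longrightarrow> indep S E \<Longrightarrow> card S \<le> r"
  shows "independence_number V E \<le> r"
  unfolding independence_number_def
proof (rule Max.boundedI)
  have "{card S | S. S \<subseteq> V \<and> indep S E} \<subseteq> card ` Pow V" by auto
  then show "finite {card S | S. S \<subseteq> V \<and> indep S E}"
    by (rule finite_subset) (simp add: assms)
  show "{card S | S. S \<subseteq> V \<and> indep S E} \<noteq> {}" by (auto simp: indep_def)
qed (use assms in auto)

lemma card_residue_le: "a < m \<Longrightarrow> card {j. j < n \<and> j mod m = a} \<le> n div m + 1" for a m n :: nat
  by (simp add: turan_part_card)

text \<open>The residue classes below \<open>s\<close> are merged and redistributed evenly over the
  \<open>m\<close> pattern vertices; the other r - s classes stay as they are. An independent set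
  has at most \<open>s\<close> vertices in the merged part and one in each untouched class. Cliques
  in untouched classes occur on both sides, so only the merged part has to be compared.\<close>

lemma blowup_beats_co_turan:
  fixes R :: "nat \<Rightarrow> nat \<Rightarrow> bool" and k m r s :: nat
  assumes sym: "\<And>a b. R a b \<Longrightarrow> R b a" and m: "0 < m" and k: "1 \<le> k" and s: "0 < s" "s \<le> r"
    and indep: "\<And>S. S \<subseteq> {..<m} \<Longrightarrow> (\<And>a b. a \<in> S \<Longrightarrow> b \<in> S \<Longrightarrow> a \<noteq> b \<Longrightarrow> \<not> R a b) \<Longrightarrow> card S \<le> s"
    and few: "card (closed_tuples k m R) * s ^ (k - 1) < m ^ k"
  shows "\<exists>N. \<forall>n\<ge>N. \<exists>E. fin_sgraph {..<n} E \<and> independence_number {..<n} E \<le> r \<and>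
    num_cliques k {..<n} E < num_cliques k {..<n} (co_turan_edges n r)"
proof -
  define w where "w = card (closed_tuples k m R)"
  obtain Q where Q: "\<And>q. Q \<le> q \<Longrightarrow> w * ((q + 1) * s div m + 1) ^ k < s * (q - k) ^ k"
    using eventually_blowup_inequality[OF m s(1) k few[folded w_def]]
    unfolding eventually_sequentially by auto
  have "\<exists>E. fin_sgraph {..<n} E \<and> independence_number {..<n} E \<le> r \<and>
      num_cliques k {..<n} E < num_cliques k {..<n} (co_turan_edges n r)" if n: "Q * r \<le> n" for n
  proof -
    define q where "q = n div r"
    have r: "0 < r" using s by simp
    have Qq: "Q \<le> q" unfolding q_def using n r by (simp add: less_eq_div_iff_mult_less_eq)
    define b where "b = (q + 1) * s div m + 1"
    \<comment> \<open>On the merged part \<open>A\<close> this is the rank of \<open>i\<close> in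
      increasing order, so reducing it modulo \<open>m\<close> splits \<open>A\<close> into almost
      equal classes.\<close>
    define idx where "idx i = i div r * s + i mod r" for i
    \<comment> \<open>Labels below \<open>m\<close> are the pattern vertices, the label \<open>m + c\<close> stands for the untouched class \<open>c\<close>.\<close>
    define \<phi> where "\<phi> i = (if i mod r < s then idx i mod m else m + i mod r)" for i
    define A where "A = {i. i < n \<and> i mod r < s}"
    \<comment> \<open>Reflexivity makes every label class a clique, and a label that is not below
      \<open>m\<close> is related only to itself.\<close>
    define R' where "R' a b \<longleftrightarrow> a = b \<or> (a < m \<and> b < m \<and> R a b)" for a b
    have R'_sym: "R' a b \<longleftrightarrow> R' b a" for a b using sym by (auto simp: R'_def)
    define E where "E = {{i, j} | i j. i < n \<and> j < n \<and> i \<noteq> j \<and> R' (\<phi> i) (\<phi> j)}"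
    have E_iff: "{i, j} \<in> E \<longleftrightarrow> i < n \<and> j < n \<and> i \<noteq> j \<and> R' (\<phi> i) (\<phi> j)" for i j
      unfolding E_def using R'_sym by (auto simp: doubleton_eq_iff)
    have \<phi>_lt: "\<phi> i < m \<longleftrightarrow> i mod r < s" for i using m by (auto simp: \<phi>_def)
    have finA: "finite A" unfolding A_def by simp

    have graph: "fin_sgraph {..<n} E"
      unfolding fin_sgraph_def E_def by auto

    have alpha: "independence_number {..<n} E \<le> r"
    proof (rule independence_number_leI)
      fix S assume S: "S \<subseteq> {..<n}" "indep S E"
      have finS: "finite S" using S(1) finite_subset by blast
      have nR: "\<not> R' (\<phi> i) (\<phi> j)" if "i \<in> S" "j \<in> S" "i \<noteq> j" for i j
        using S that E_iff[of i j] unfolding indep_def by blast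
      \<comment> \<open>By reflexivity of \<open>R'\<close> an independent set never repeats a
        label, so it suffices to count labels: those below \<open>m\<close> form an independent set
        of the pattern, and at most r - s others exist.\<close>
      then have "inj_on \<phi> S" by (auto simp: inj_on_def R'_def)
      then have "card S = card (\<phi> ` S)" by (simp add: card_image)
      also have "\<phi> ` S = (\<phi> ` S \<inter> {..<m}) \<union> (\<phi> ` S - {..<m})" by auto
      also have "card \<dots> \<le> card (\<phi> ` S \<inter> {..<m}) + card (\<phi> ` S - {..<m})" by (rule card_Un_le)
      also have "\<dots> \<le> s + (r - s)"
      proof (rule add_mono)
        show "card (\<phi> ` S \<inter> {..<m}) \<le> s"
          by (rule indep) (use nR in \<open>auto simp: R'_def\<close>)
        have "\<phi> ` S - {..<m} \<subseteq> (\<lambda>c. m + c) ` {s..<r}"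
          using r m by (auto simp: \<phi>_def image_iff split: if_splits)
        then have "card (\<phi> ` S - {..<m}) \<le> card ((\<lambda>c. m + c) ` {s..<r})"
          by (intro card_mono) auto
        also have "\<dots> \<le> card {s..<r}" by (rule card_image_le) simp
        finally show "card (\<phi> ` S - {..<m}) \<le> r - s" by simp
      qed
      finally show "card S \<le> r" using s by simp
    qed simp

    have fibre: "card {i \<in> A. \<phi> i = a} \<le> b" for a
    proof (cases "a < m")
      case False
      then have "{i \<in> A. \<phi> i = a} = {}" using \<phi>_lt by (auto simp: A_def)
      then show ?thesis by (simp only: card.empty)
    next
      case True
      have inj: "inj_on idx {i \<in> A. \<phi> i = a}"
      proof (rule inj_onI)
        fix i j assume ij: "i \<in> {i \<in> A. \<phi> i = a}" "j \<in> {i \<in> A. \<phi> i = a}" "idx i = idx j"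
        have lt: "i mod r < s" "j mod r < s" using ij by (auto simp: A_def)
        have "idx i div s = i div r" "idx j div s = j div r" "idx i mod s = i mod r" "idx j mod s = j mod r"
          using lt s by (simp_all add: idx_def)
        then have "i div r = j div r" "i mod r = j mod r" using ij(3) by simp_all
        then show "i = j" by (metis div_mult_mod_eq)
      qed
      \<comment> \<open>The factor is \<open>q + 1\<close> and not \<open>q\<close> because the last
        block of \<open>r\<close> vertices may be incomplete.\<close>
      have "idx ` {i \<in> A. \<phi> i = a} \<subseteq> {j. j < (q + 1) * s \<and> j mod m = a}"
      proof
        fix x assume "x \<in> idx ` {i \<in> A. \<phi> i = a}"
        then obtain i where i: "x = idx i" "i < n" "i mod r < s" "idx i mod m = a"
          by (auto simp: A_def \<phi>_def)
        have "i div r \<le> q" using i unfolding q_def by (simp add: div_le_mono)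
        then have "i div r * s \<le> q * s" by simp
        then have "i div r * s + i mod r < q * s + s" using i by linarith
        then have "idx i < (q + 1) * s" by (simp add: idx_def)
        then show "x \<in> {j. j < (q + 1) * s \<and> j mod m = a}" using i by simp
      qed
      then have "card {i \<in> A. \<phi> i = a} \<le> card {j. j < (q + 1) * s \<and> j mod m = a}"
        by (intro card_inj_on_le[OF inj]) auto
      also have "\<dots> \<le> b" unfolding b_def by (rule card_residue_le[OF True])
      finally show ?thesis .
    qed

    \<comment> \<open>\<open>KA\<close> holds the cliques inside the merged part, \<open>D\<close>
      the \<open>k\<close>-sets inside an untouched class, which are cliques of both graphs, and
      \<open>U\<close> the \<open>k\<close>-sets inside one of the \<open>s\<close> original cliques
      that were replaced.\<close>
    define KA where "KA = {S. S \<subseteq> A \<and> card S = k \<and> clique S E}"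
    define D where "D = {S. S \<subseteq> {..<n} \<and> card S = k \<and> (\<exists>c. s \<le> c \<and> (\<forall>i\<in>S. i mod r = c))}"
    define U where "U = (\<Union>c\<in>{..<s}. {S. S \<subseteq> {i. i < n \<and> i mod r = c} \<and> card S = k})"
    have "card KA * fact k \<le> w * b ^ k" unfolding w_def
    proof (rule card_sets_le_closed_tuples[OF finA fibre])
      fix S assume S: "S \<in> KA"
      have "\<phi> x = \<phi> y \<or> R (\<phi> x) (\<phi> y)" if "x \<in> S" "y \<in> S" for x y
        using S that E_iff[of x y] unfolding KA_def clique_def R'_def by auto
      then show "S \<subseteq> A \<and> card S = k \<and> (\<forall>x\<in>S. \<forall>y\<in>S. \<phi> x = \<phi> y \<or> R (\<phi> x) (\<phi> y))"
        using S by (auto simp: KA_def)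
    qed (auto simp: A_def \<phi>_lt)
    also have "\<dots> < s * (q - k) ^ k" unfolding b_def by (rule Q[OF Qq])
    also have "\<dots> \<le> s * (fact k * (q choose k))"
      using power_diff_le_fact_binomial by (intro mult_left_mono) auto
    also have "\<dots> = (s * (q choose k)) * fact k" by simp
    finally have KA_lt: "card KA < s * (q choose k)" by simp

    \<comment> \<open>Since \<open>k\<close> is positive, a \<open>k\<close>-set determines its
      residue class; the empty set would lie in every class and spoil the disjointness
      below.\<close>
    have nonempty: "S \<noteq> {}" if "card S = k" for S :: "nat set" using that k by auto
    have finU: "finite U"
      unfolding U_def by (rule finite_UN_I) auto
    have finD: "finite D" unfolding D_def
      by (rule finite_subset[of _ "Pow {..<n}"]) auto
    have U_ge: "s * (q choose k) \<le> card U"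
    proof -
      have "card U = (\<Sum>c\<in>{..<s}. card {S. S \<subseteq> {i. i < n \<and> i mod r = c} \<and> card S = k})"
        unfolding U_def
      proof (rule card_UN_disjoint)
        show "\<forall>c\<in>{..<s}. \<forall>d\<in>{..<s}. c \<noteq> d \<longrightarrow>
          {S. S \<subseteq> {i. i < n \<and> i mod r = c} \<and> card S = k} \<inter>
          {S. S \<subseteq> {i. i < n \<and> i mod r = d} \<and> card S = k} = {}"
          using nonempty by blast
      qed auto
      also have "\<dots> = (\<Sum>c\<in>{..<s}. card {i. i < n \<and> i mod r = c} choose k)"
        by (intro sum.cong refl n_subsets) simp
      also have "\<dots> \<ge> (\<Sum>c\<in>{..<s}. q choose k)"
        using s by (intro sum_mono binomial_right_mono) (auto simp: turan_part_card q_def)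
      finally show ?thesis by simp
    qed
    have "D \<inter> U = {}"
    proof -
      have False if "S \<in> D" "S \<in> U" for S
      proof -
        obtain i where "i \<in> S" using nonempty[of S] \<open>S \<in> D\<close> unfolding D_def by blast
        then show False using that unfolding D_def U_def by fastforce
      qed
      then show ?thesis by blast
    qed
    then have "card D + card U = card (D \<union> U)" by (simp add: card_Un_disjoint finD finU)
    also have "\<dots> \<le> num_cliques k {..<n} (co_turan_edges n r)"
      unfolding num_cliques_def
    proof (rule card_mono)
      show "finite {S. S \<subseteq> {..<n} \<and> card S = k \<and> clique S (co_turan_edges n r)}"
        by (rule finite_subset[of _ "Pow {..<n}"]) auto
      show "D \<union> U \<subseteq> {S. S \<subseteq> {..<n} \<and> card S = k \<and> clique S (co_turan_edges n r)}"
        unfolding D_def U_def clique_def doubleton_in_co_turan_edges by auto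
    qed
    finally have turan: "card D + card U \<le> num_cliques k {..<n} (co_turan_edges n r)" .

    have "num_cliques k {..<n} E \<le> card (KA \<union> D)"
      unfolding num_cliques_def
    proof (rule card_mono)
      show "finite (KA \<union> D)" using finD finA unfolding KA_def by simp
      show "{S. S \<subseteq> {..<n} \<and> card S = k \<and> clique S E} \<subseteq> KA \<union> D"
      proof
        fix S assume "S \<in> {S. S \<subseteq> {..<n} \<and> card S = k \<and> clique S E}"
        then have S: "S \<subseteq> {..<n}" "card S = k" "clique S E" by auto
        have R': "R' (\<phi> i) (\<phi> j)" if "i \<in> S" "j \<in> S" for i j
          using S(3) that E_iff[of i j] unfolding clique_def R'_def by auto
        show "S \<in> KA \<union> D"
        proof (cases "S \<subseteq> A")
          case True
          then show ?thesis using S by (simp add: KA_def)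
        next
          case False
          then obtain i where "i \<in> S" "i \<notin> A" by blast
          then have i: "i \<in> S" "s \<le> i mod r" using S(1) by (auto simp: A_def)
          \<comment> \<open>A clique containing a vertex of an untouched class carries a single
            label, hence stays inside that class.\<close>
          have "j mod r = i mod r" if "j \<in> S" for j
          proof -
            have "\<not> \<phi> i < m" using i by (simp add: \<phi>_lt)
            then have "\<phi> j = \<phi> i" using R'[OF that i(1)] by (auto simp: R'_def)
            moreover from this have "\<not> j mod r < s" using \<open>\<not> \<phi> i < m\<close> \<phi>_lt by metis
            ultimately show ?thesis using i by (simp add: \<phi>_def)
          qed
          then have "S \<in> D" unfolding D_def using S(1,2) i(2) by blast
          then show ?thesis ..
        qed
      qed
    qed
    also have "\<dots> \<le> card KA + card D" by (rule card_Un_le)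
    also have "\<dots> < num_cliques k {..<n} (co_turan_edges n r)"
      using KA_lt U_ge turan by linarith
    finally show ?thesis using graph alpha by blast
  qed
  then show ?thesis by blast
qed

section \<open>The pentagon\<close>

definition pentagon :: "nat \<Rightarrow> nat \<Rightarrow> bool" where
  "pentagon a b \<longleftrightarrow> a < 5 \<and> b < 5 \<and> (b = (a + 1) mod 5 \<or> a = (b + 1) mod 5)"

lemma pentagon_indep:
  assumes "S \<subseteq> {..<5}" "\<And>a b. a \<in> S \<Longrightarrow> b \<in> S \<Longrightarrow> a \<noteq> b \<Longrightarrow> \<not> pentagon a b"
  shows "card S \<le> 2"
proof -
  \<comment> \<open>A check of all 32 subsets against the five edges of the cycle.\<close>
  have "{..<5} = {0, 1, 2, 3, 4::nat}" by auto
  then have "S \<in> Pow {0, 1, 2, 3, 4}" using assms(1) by auto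
  moreover have "\<not> (0 \<in> S \<and> 1 \<in> S)" "\<not> (1 \<in> S \<and> 2 \<in> S)" "\<not> (2 \<in> S \<and> 3 \<in> S)"
    "\<not> (3 \<in> S \<and> 4 \<in> S)" "\<not> (4 \<in> S \<and> 0 \<in> S)"
    using assms(2)[of 0 1] assms(2)[of 1 2] assms(2)[of 2 3] assms(2)[of 3 4] assms(2)[of 4 0]
    by (auto simp: pentagon_def)
  ultimately show ?thesis by (auto simp: Pow_insert)
qed

text \<open>The pentagon has no triangle, so after a first entry \<open>x\<close> the other
  \<open>k\<close> entries use \<open>x\<close> and only one of its neighbours x + 1 and x - 1, the
  latter written \<open>(x + 4) mod 5\<close>. Each choice gives 2^k lists, and the constant list is
  counted twice.\<close>

lemma card_pentagon_closed_tuples_le: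
  "card (closed_tuples (Suc k) 5 pentagon) \<le> 5 * (2 ^ Suc k - 1)"
proof -
  define up where "up x = {ys. set ys \<subseteq> {x, (x + 1) mod 5} \<and> length ys = k}" for x :: nat
  define down where "down x = {ys. set ys \<subseteq> {x, (x + 4) mod 5} \<and> length ys = k}" for x :: nat
  have card_le: "card (up x \<union> down x) \<le> 2 ^ Suc k - 1" if "x < 5" for x
  proof -
    have x: "x \<in> {0, 1, 2, 3, 4}" using that by auto
    have "card {x, (x + 1) mod 5} = 2" "card {x, (x + 4) mod 5} = 2" using x by auto
    then have c: "card (up x) = 2 ^ k" "card (down x) = 2 ^ k"
      unfolding up_def down_def by (simp_all add: card_lists_length_eq)
    have fin: "finite (up x)" "finite (down x)"
      unfolding up_def down_def by (simp_all add: finite_lists_length_eq)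
    have "replicate k x \<in> up x \<inter> down x" by (auto simp: up_def down_def)
    then have "card (up x \<inter> down x) \<ge> 1"
      using fin by (metis One_nat_def Suc_leI card_gt_0_iff empty_iff finite_Int)
    then show ?thesis using card_Un_Int[OF fin] c by simp
  qed
  have "closed_tuples (Suc k) 5 pentagon \<subseteq> (\<Union>x\<in>{..<5}. (#) x ` (up x \<union> down x))"
  proof
    fix xs assume xs: "xs \<in> closed_tuples (Suc k) 5 pentagon"
    then obtain x ys where eq: "xs = x # ys" by (cases xs) (auto simp: closed_tuples_def)
    have ys: "length ys = k" "x < 5" "set ys \<subseteq> {..<5}" using xs eq by (auto simp: closed_tuples_def)
    have pent: "a = b \<or> pentagon a b" if "a \<in> insert x (set ys)" "b \<in> insert x (set ys)" for a b
      using xs that unfolding eq closed_tuples_def by auto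
    have nbr: "a \<in> {x, (x + 1) mod 5, (x + 4) mod 5}" if "a \<in> set ys" for a
    proof -
      have "a < 5" using that ys by auto
      then have "a \<in> {0, 1, 2, 3, 4}" "x \<in> {0, 1, 2, 3, 4}" using \<open>x < 5\<close> by auto
      then show ?thesis using pent[of x a] that by (auto simp: pentagon_def)
    qed
    have "\<not> ((x + 1) mod 5 \<in> set ys \<and> (x + 4) mod 5 \<in> set ys)"
    proof -
      have "x \<in> {0, 1, 2, 3, 4}" using \<open>x < 5\<close> by auto
      then have "(x + 1) mod 5 \<noteq> (x + 4) mod 5 \<and> \<not> pentagon ((x + 1) mod 5) ((x + 4) mod 5)"
        by (auto simp: pentagon_def)
      then show ?thesis using pent[of "(x + 1) mod 5" "(x + 4) mod 5"] by auto
    qed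
    then have "ys \<in> up x \<union> down x" using nbr ys(1) unfolding up_def down_def by blast
    then show "xs \<in> (\<Union>x\<in>{..<5}. (#) x ` (up x \<union> down x))" using eq ys(2) by auto
  qed
  moreover have fin: "finite (up x \<union> down x)" for x
    unfolding up_def down_def by (simp add: finite_lists_length_eq)
  ultimately have "card (closed_tuples (Suc k) 5 pentagon)
      \<le> card (\<Union>x\<in>{..<5}. (#) x ` (up x \<union> down x))"
    by (intro card_mono) auto
  also have "\<dots> \<le> (\<Sum>x\<in>{..<5}. card ((#) x ` (up x \<union> down x)))" by (rule card_UN_le) simp
  also have "\<dots> \<le> (\<Sum>x\<in>{..<5::nat}. 2 ^ Suc k - 1)"
    by (intro sum_mono order_trans[OF card_image_le[OF fin] card_le]) simp
  finally show ?thesis by simp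
qed

text \<open>The left side grows by a factor below 5 in each step. The start is 600 < 625 at k = 4;
  at k = 3 the inequality fails with 140 > 125, which is why the case k = 3 takes another
  pattern.\<close>

lemma pentagon_inequality:
  assumes "4 \<le> k"
  shows "5 * (2 ^ k - 1) * 2 ^ (k - 1) < (5 ^ k :: nat)"
  using assms
proof (induction k rule: dec_induct)
  case (step k)
  obtain j where j: "k = Suc j" using step(1) by (cases k) auto
  have big: "16 \<le> (2::nat) ^ k" using power_increasing[OF step(1), of "2::nat"] by simp
  have "5 * (2 ^ Suc k - 1) * 2 ^ (Suc k - 1) = 5 * (2 ^ Suc k - 1) * 2 * (2::nat) ^ (k - 1)"
    by (simp add: j)
  also have "\<dots> \<le> 25 * (2 ^ k - 1) * 2 ^ (k - 1)"
    using big by (intro mult_le_mono1) (simp add: diff_mult_distrib2)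
  also have "\<dots> = 5 * (5 * (2 ^ k - 1) * 2 ^ (k - 1))" by simp
  also have "\<dots> < 5 * 5 ^ k" using step.IH by linarith
  finally show ?case by simp
qed simp

lemma co_turan_beaten_ge_4:
  fixes k r :: nat
  assumes "4 \<le> k" "2 \<le> r"
  shows "\<exists>N. \<forall>n\<ge>N. \<exists>E. fin_sgraph {..<n} E \<and> independence_number {..<n} E \<le> r \<and>
    num_cliques k {..<n} E < num_cliques k {..<n} (co_turan_edges n r)"
proof (rule blowup_beats_co_turan[where R = pentagon and m = 5 and s = 2])
  show "card (closed_tuples k 5 pentagon) * 2 ^ (k - 1) < 5 ^ k"
  proof -
    obtain j where "k = Suc j" using assms by (cases k) auto
    then have "card (closed_tuples k 5 pentagon) * 2 ^ (k - 1) \<le> 5 * (2 ^ k - 1) * 2 ^ (k - 1)"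
      using card_pentagon_closed_tuples_le[of j] by (intro mult_le_mono1) simp
    then show ?thesis using pentagon_inequality[OF assms(1)] by linarith
  qed
qed (use assms pentagon_indep in \<open>auto simp: pentagon_def\<close>)

section \<open>Random pattern graphs\<close>

text \<open>
  A function that is affine in each coordinate does not exceed its value at \<open>x\<close> at some vertex
  of the cube; this replaces the expectation over a random graph.
\<close>

lemma multiaffine_vertex_le:
  fixes F :: "('e \<Rightarrow> real) \<Rightarrow> real"
  assumes "finite P"
    and aff: "\<And>x e. F x = (1 - x e) * F (x(e := 0)) + x e * F (x(e := 1))"
    and "\<And>e. e \<in> P \<Longrightarrow> 0 \<le> x e \<and> x e \<le> 1"
  shows "\<exists>y. (\<forall>e\<in>P. y e \<in> {0, 1}) \<and> (\<forall>e. e \<notin> P \<longrightarrow> y e = x e) \<and> F y \<le> F x"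
  using assms(1,3)
proof (induction P arbitrary: x rule: finite_induct)
  case empty
  then show ?case by auto
next
  case (insert e P)
  \<comment> \<open>\<open>F x\<close> is a weighted average of the two values, so it cannot be
    smaller than both; the coordinate \<open>e\<close> is rounded to the better end.\<close>
  have "F (x(e := 0)) \<le> F x \<or> F (x(e := 1)) \<le> F x"
  proof (rule ccontr)
    assume "\<not> ?thesis"
    then have gt: "F x < F (x(e := 0))" "F x < F (x(e := 1))" by auto
    have x: "0 \<le> x e" "x e \<le> 1" using insert.prems by auto
    have "(1 - x e) * F x + x e * F x < (1 - x e) * F (x(e := 0)) + x e * F (x(e := 1))"
    proof (cases "x e = 0")
      case False
      then show ?thesis using gt x
        by (intro add_le_less_mono mult_left_mono mult_strict_left_mono) auto
    qed (use gt in simp)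
    then show False using aff[of x e] by (simp add: algebra_simps)
  qed
  then obtain v where v: "v \<in> {0, 1}" "F (x(e := v)) \<le> F x" by auto
  obtain y where y: "\<forall>a\<in>P. y a \<in> {0, 1}" "\<forall>a. a \<notin> P \<longrightarrow> y a = (x(e := v)) a"
    "F y \<le> F (x(e := v))"
    using insert.IH[of "x(e := v)"] insert.prems insert.hyps by fastforce
  have "\<forall>a\<in>insert e P. y a \<in> {0, 1}" using y(1,2) v(1) insert.hyps(2) by auto
  moreover have "\<forall>a. a \<notin> insert e P \<longrightarrow> y a = x a" using y(2) by auto
  ultimately show ?case using y(3) v(2) order_trans by blast
qed

text \<open>The factors depend on distinct coordinates, so \<open>e\<close> enters at most one of
  them, and that one is affine.\<close>

lemma multiaffine_prod:
  fixes x :: "'e \<Rightarrow> real"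
  assumes "finite T" "\<And>v. g v = (1 - v) * g 0 + v * (g 1 :: real)"
  shows "(\<Prod>a\<in>T. g (x a))
    = (1 - x e) * (\<Prod>a\<in>T. g ((x(e := 0)) a)) + x e * (\<Prod>a\<in>T. g ((x(e := 1)) a))"
proof (cases "e \<in> T")
  case True
  have rest: "(\<Prod>a\<in>T - {e}. g ((x(e := v)) a)) = (\<Prod>a\<in>T - {e}. g (x a))" for v
    by (intro prod.cong) auto
  have split: "(\<Prod>a\<in>T. h a) = h e * (\<Prod>a\<in>T - {e}. h a)" for h :: "'e \<Rightarrow> real"
    using assms(1) True by (rule prod.remove)
  show ?thesis
    unfolding split rest by (subst assms(2)[of "x e"]) (simp add: algebra_simps)
next
  case False
  then have "(\<Prod>a\<in>T. g ((x(e := v)) a)) = (\<Prod>a\<in>T. g (x a))" for v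
    by (intro prod.cong) auto
  then show ?thesis by (simp add: algebra_simps)
qed

lemma card_nsets: "finite A \<Longrightarrow> card ([A]\<^bsup>k\<^esup>) = card A choose k"
proof -
  assume "finite A"
  then have "[A]\<^bsup>k\<^esup> = {B. B \<subseteq> A \<and> card B = k}" by (auto simp: nsets_def finite_subset)
  then show ?thesis using n_subsets[OF \<open>finite A\<close>] by simp
qed

text \<open>The left side is the probability that the triple is closed in a random graph: 1,
  \<open>p\<close> or p^3 according to whether it has one, two or three distinct entries. The right
  side adds the three cases with overlaps, in a form that can be summed.\<close>

lemma power_pairs_triple_le:
  fixes p :: real
  assumes "0 \<le> p"
  shows "p ^ card ([{a, b, c}]\<^bsup>2\<^esup>)
    \<le> of_bool (a = b) * of_bool (b = c) + p * (of_bool (a = b) + of_bool (b = c) + of_bool (a = c)) + p ^ 3"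
proof -
  have "card {a, b, c} choose 2 = (if a = b \<and> b = c then 0 else if a = b \<or> b = c \<or> a = c then 1 else 3)"
    by (auto simp: choose_two card_insert_if)
  then show ?thesis using assms by (auto simp: card_nsets)
qed

text \<open>Bounds the expected number of closed triples: \<open>m\<close> constant ones, three ways
  to force two entries equal with m^2 triples each, and m^3 triples in all.\<close>

lemma sum_pairs_triple_le:
  fixes p :: real
  assumes "0 \<le> p"
  shows "(\<Sum>a<m. \<Sum>b<m. \<Sum>c<m. p ^ card ([{a, b, c}]\<^bsup>2\<^esup>))
    \<le> real m + 3 * p * real m ^ 2 + p ^ 3 * real m ^ 3"
proof -
  define \<delta> :: "nat \<Rightarrow> nat \<Rightarrow> real" where "\<delta> a b = of_bool (a = b)" for a b
  have \<delta>: "(\<Sum>b<m. \<delta> a b) = 1" if "a < m" for a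
    using that by (simp add: \<delta>_def of_bool_def)
  have \<delta>2: "(\<Sum>a<m. \<Sum>b<m. \<delta> a b) = real m" by (simp add: \<delta>)
  have all: "(\<Sum>a<m. \<Sum>b<m. \<Sum>c<m. \<delta> a b * \<delta> b c) = real m"
  proof -
    have "(\<Sum>a<m. \<Sum>b<m. \<Sum>c<m. \<delta> a b * \<delta> b c) = (\<Sum>a<m. \<Sum>b<m. \<delta> a b)"
      by (intro sum.cong refl) (simp add: \<delta> flip: sum_distrib_left)
    then show ?thesis by (simp only: \<delta>2)
  qed
  have two: "(\<Sum>a<m. \<Sum>b<m. \<Sum>c<m. p * (\<delta> a b + \<delta> b c + \<delta> a c)) = 3 * p * real m ^ 2"
  proof -
    have "(\<Sum>a<m. \<Sum>b<m. \<Sum>c<m. p * (\<delta> a b + \<delta> b c + \<delta> a c))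
        = (\<Sum>a<m. \<Sum>b<m. p * (real m * \<delta> a b + 2))"
      by (intro sum.cong refl) (simp add: \<delta> sum.distrib flip: sum_distrib_left)
    also have "\<dots> = (\<Sum>a<m. p * (3 * real m))"
      by (intro sum.cong refl) (simp add: \<delta> sum.distrib flip: sum_distrib_left)
    finally show ?thesis by (simp add: power2_eq_square)
  qed
  have "(\<Sum>a<m. \<Sum>b<m. \<Sum>c<m. p ^ card ([{a, b, c}]\<^bsup>2\<^esup>))
    \<le> (\<Sum>a<m. \<Sum>b<m. \<Sum>c<m. \<delta> a b * \<delta> b c + p * (\<delta> a b + \<delta> b c + \<delta> a c) + p ^ 3)"
    unfolding \<delta>_def by (intro sum_mono power_pairs_triple_le assms)
  also have "\<dots> = (\<Sum>a<m. \<Sum>b<m. \<Sum>c<m. \<delta> a b * \<delta> b c)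
      + (\<Sum>a<m. \<Sum>b<m. \<Sum>c<m. p * (\<delta> a b + \<delta> b c + \<delta> a c)) + (\<Sum>a<m. \<Sum>b<m. \<Sum>c<m. p ^ 3)"
    by (simp only: sum.distrib)
  also have "(\<Sum>a<m. \<Sum>b<m. \<Sum>c<m. p ^ 3) = p ^ 3 * real m ^ 3" by (simp add: power3_eq_cube)
  finally show ?thesis unfolding all two .
qed

text \<open>First moment method. The hypothesis bounds the expectation of the scaled closed-triple
  count plus the number of independent \<open>s\<close>-sets by 1. Some graph is no worse than the
  expectation; there the second count, an integer, must vanish, and the scaled first count is below
  1.\<close>

lemma exists_pattern_graph:
  fixes p :: real and m s r :: nat
  assumes p: "0 \<le> p" "p \<le> 1" and m: "0 < m"
    and lt: "(real m + 3 * p * real m ^ 2 + p ^ 3 * real m ^ 3) * real r ^ 2 / real m ^ 3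
      + real (m choose s) * (1 - p) ^ (s choose 2) < 1"
  shows "\<exists>R. (\<forall>a b. R a b \<longrightarrow> R b a) \<and>
    (\<forall>S. S \<subseteq> {..<m} \<and> (\<forall>a\<in>S. \<forall>b\<in>S. a \<noteq> b \<longrightarrow> \<not> R a b) \<longrightarrow> card S < s) \<and>
    card (closed_tuples 3 m R) * r ^ 2 < m ^ 3"
proof -
  define c where "c = real r ^ 2 / real m ^ 3"
  have c: "0 \<le> c" by (simp add: c_def)
  \<comment> \<open>\<open>T\<close> and \<open>I\<close> are polynomials in the edge probabilities,
    affine in each of them. At a 0/1 point they count closed triples and independent
    \<open>s\<close>-sets; at the constant \<open>p\<close> they are the expected counts.\<close>
  define T where "T x = (\<Sum>i<m. \<Sum>j<m. \<Sum>k<m. \<Prod>e\<in>[{i, j, k}]\<^bsup>2\<^esup>. x e)" for x :: "nat set \<Rightarrow> real"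
  define I where "I x = (\<Sum>S\<in>[{..<m}]\<^bsup>s\<^esup>. \<Prod>e\<in>[S]\<^bsup>2\<^esup>. 1 - x e)" for x :: "nat set \<Rightarrow> real"
  define F where "F x = c * T x + I x" for x
  have fin2: "finite ([S]\<^bsup>2\<^esup>)" if "finite S" for S :: "nat set"
    using that by (rule finite_imp_finite_nsets)
  have finS: "finite S" if "S \<in> [{..<m}]\<^bsup>s\<^esup>" for S using that by (simp add: nsets_def)
  have affT: "T x = (1 - x e) * T (x(e := 0)) + x e * T (x(e := 1))" for x e
  proof -
    have "T x = (\<Sum>i<m. \<Sum>j<m. \<Sum>k<m. (1 - x e) * (\<Prod>a\<in>[{i, j, k}]\<^bsup>2\<^esup>. (x(e := 0)) a)
        + x e * (\<Prod>a\<in>[{i, j, k}]\<^bsup>2\<^esup>. (x(e := 1)) a))"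
      unfolding T_def
      by (intro sum.cong refl multiaffine_prod[where g = "\<lambda>v. v"] fin2) auto
    also have "\<dots> = (1 - x e) * T (x(e := 0)) + x e * T (x(e := 1))"
      unfolding T_def sum_distrib_left sum.distrib ..
    finally show ?thesis .
  qed
  have affI: "I x = (1 - x e) * I (x(e := 0)) + x e * I (x(e := 1))" for x e
  proof -
    have "I x = (\<Sum>S\<in>[{..<m}]\<^bsup>s\<^esup>. (1 - x e) * (\<Prod>a\<in>[S]\<^bsup>2\<^esup>. 1 - (x(e := 0)) a)
        + x e * (\<Prod>a\<in>[S]\<^bsup>2\<^esup>. 1 - (x(e := 1)) a))"
      unfolding I_def
      by (intro sum.cong refl multiaffine_prod[where g = "\<lambda>v. 1 - v"] fin2 finS) auto
    also have "\<dots> = (1 - x e) * I (x(e := 0)) + x e * I (x(e := 1))"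
      unfolding I_def sum_distrib_left sum.distrib ..
    finally show ?thesis .
  qed
  have aff: "F x = (1 - x e) * F (x(e := 0)) + x e * F (x(e := 1))" for x e
    unfolding F_def by (subst affT[of x e], subst affI[of x e]) (simp add: algebra_simps)

  have "I (\<lambda>_. p) = (\<Sum>S\<in>[{..<m}]\<^bsup>s\<^esup>. (1 - p) ^ (s choose 2))"
    unfolding I_def
  proof (intro sum.cong refl)
    fix S assume "S \<in> [{..<m}]\<^bsup>s\<^esup>"
    then have "finite S" "card S = s" by (auto simp: nsets_def)
    then show "(\<Prod>e\<in>[S]\<^bsup>2\<^esup>. 1 - p) = (1 - p) ^ (s choose 2)" by (simp add: card_nsets)
  qed
  then have I_p: "I (\<lambda>_. p) = real (m choose s) * (1 - p) ^ (s choose 2)"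
    by (simp add: card_nsets)
  have "T (\<lambda>_. p) \<le> real m + 3 * p * real m ^ 2 + p ^ 3 * real m ^ 3"
    unfolding T_def using sum_pairs_triple_le[OF p(1)] by simp
  then have "c * T (\<lambda>_. p) \<le> c * (real m + 3 * p * real m ^ 2 + p ^ 3 * real m ^ 3)"
    using c by (rule mult_left_mono)
  then have F_p: "F (\<lambda>_. p) < 1"
    using lt unfolding F_def I_p c_def by (simp add: mult.commute)

  obtain y where y: "\<forall>e\<in>[{..<m}]\<^bsup>2\<^esup>. y e \<in> {0, 1}" "F y \<le> F (\<lambda>_. p)"
    using multiaffine_vertex_le[of "[{..<m}]\<^bsup>2\<^esup>" F "\<lambda>_. p", OF fin2 aff] p by auto
  have Fy: "c * T y + I y < 1" using y(2) F_p by (simp add: F_def)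
  have y01: "y e \<in> {0, 1}" if "e \<in> [S]\<^bsup>2\<^esup>" "S \<subseteq> {..<m}" for e S
    using y(1) that nsets_mono[OF that(2)] by blast
  have Tnn: "0 \<le> (\<Prod>e\<in>[{i, j, k}]\<^bsup>2\<^esup>. y e)" if "i < m" "j < m" "k < m" for i j k
  proof (rule prod_nonneg)
    fix e assume e: "e \<in> [{i, j, k}]\<^bsup>2\<^esup>"
    have "{i, j, k} \<subseteq> {..<m}" using that by simp
    with e have "y e \<in> {0, 1}" by (rule y01)
    then show "0 \<le> y e" by auto
  qed
  have Inn: "0 \<le> (\<Prod>e\<in>[S]\<^bsup>2\<^esup>. 1 - y e)" if "S \<in> [{..<m}]\<^bsup>s\<^esup>" for S
  proof (rule prod_nonneg)
    fix e assume e: "e \<in> [S]\<^bsup>2\<^esup>"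
    have "S \<subseteq> {..<m}" using that by (simp add: nsets_def)
    with e have "y e \<in> {0, 1}" by (rule y01)
    then show "0 \<le> 1 - y e" by auto
  qed
  define R where "R a b \<longleftrightarrow> a < m \<and> b < m \<and> a \<noteq> b \<and> y {a, b} = 1" for a b
  have sym: "R a b \<longrightarrow> R b a" for a b by (auto simp: R_def insert_commute)

  have alpha: "card S < s" if S: "S \<subseteq> {..<m}" "\<forall>a\<in>S. \<forall>b\<in>S. a \<noteq> b \<longrightarrow> \<not> R a b" for S
  \<comment> \<open>An \<open>s\<close>-subset of a larger independent set would contribute a full
    summand 1 to \<open>I y\<close>, contradicting \<open>Fy\<close>.\<close>
  proof (rule ccontr)
    assume "\<not> card S < s"
    then obtain S' where S': "S' \<subseteq> S" "card S' = s"
      by (meson not_less obtain_subset_with_card_n)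
    have S'm: "S' \<in> [{..<m}]\<^bsup>s\<^esup>" using S' S(1) finite_subset[of S' "{..<m}"] by (auto simp: nsets_def)
    have "(\<Prod>e\<in>[S']\<^bsup>2\<^esup>. 1 - y e) = 1"
    proof (rule prod.neutral, rule ballI)
      fix e assume e: "e \<in> [S']\<^bsup>2\<^esup>"
      then obtain a b where ab: "e = {a, b}" "a \<in> S'" "b \<in> S'" "a \<noteq> b" by (auto elim: nsets2_E)
      then have "\<not> R a b" "a < m" "b < m" using S S' by auto
      then have "y e \<noteq> 1" using ab by (auto simp: R_def)
      moreover have "y e \<in> {0, 1}" using y01[OF e] S' S(1) by blast
      ultimately show "1 - y e = 1" by auto
    qed
    then have "1 \<le> I y"
      unfolding I_def using member_le_sum[of S' "[{..<m}]\<^bsup>s\<^esup>" "\<lambda>S. \<Prod>e\<in>[S]\<^bsup>2\<^esup>. 1 - y e"] S'm Inn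
      by (simp add: finite_imp_finite_nsets)
    moreover have "0 \<le> T y" unfolding T_def using Tnn by (intro sum_nonneg) auto
    ultimately show False using Fy c by (smt (verit) mult_nonneg_nonneg)
  qed

  \<comment> \<open>Closed triples are recounted as index triples, so that each is matched with a
    summand of \<open>T y\<close>, which is 1 for a closed triple and nonnegative otherwise.\<close>
  let ?X = "{..<m} \<times> {..<m} \<times> {..<m}"
  have "closed_tuples 3 m R \<subseteq> (\<lambda>(i, j, k). [i, j, k]) ` {t \<in> ?X. case t of (i, j, k) \<Rightarrow> [i, j, k] \<in> closed_tuples 3 m R}"
  proof
    fix xs assume xs: "xs \<in> closed_tuples 3 m R"
    then obtain i j k where "xs = [i, j, k]"
      by (auto simp: closed_tuples_def eval_nat_numeral length_Suc_conv)
    moreover have "(i, j, k) \<in> ?X" using xs calculation by (auto simp: closed_tuples_def)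
    ultimately show "xs \<in> (\<lambda>(i, j, k). [i, j, k]) ` {t \<in> ?X. case t of (i, j, k) \<Rightarrow> [i, j, k] \<in> closed_tuples 3 m R}"
      using xs by force
  qed
  then have "card (closed_tuples 3 m R) \<le> card {t \<in> ?X. case t of (i, j, k) \<Rightarrow> [i, j, k] \<in> closed_tuples 3 m R}"
    by (rule surj_card_le[rotated]) (auto intro: finite_subset[of _ ?X])
  also have "\<dots> = (\<Sum>t\<in>?X. of_bool (case t of (i, j, k) \<Rightarrow> [i, j, k] \<in> closed_tuples 3 m R))"
    by (simp add: sum.inter_filter[symmetric] of_bool_def)
  finally have "real (card (closed_tuples 3 m R))
      \<le> real (\<Sum>t\<in>?X. of_bool (case t of (i, j, k) \<Rightarrow> [i, j, k] \<in> closed_tuples 3 m R))"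
    by (rule of_nat_mono)
  also have "\<dots> = (\<Sum>t\<in>?X. of_bool (case t of (i, j, k) \<Rightarrow> [i, j, k] \<in> closed_tuples 3 m R))"
    by (simp only: of_nat_sum of_nat_of_bool)
  also have "\<dots> \<le> (\<Sum>t\<in>?X. case t of (i, j, k) \<Rightarrow> \<Prod>e\<in>[{i, j, k}]\<^bsup>2\<^esup>. y e)"
  proof (rule sum_mono)
    fix t assume "t \<in> ?X"
    then obtain i j k where t: "t = (i, j, k)" and ijk: "i < m" "j < m" "k < m" by auto
    have "(\<Prod>e\<in>[{i, j, k}]\<^bsup>2\<^esup>. y e) = 1" if "[i, j, k] \<in> closed_tuples 3 m R"
    proof (rule prod.neutral, rule ballI)
      fix e assume "e \<in> [{i, j, k}]\<^bsup>2\<^esup>"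
      then obtain a b where "e = {a, b}" "a \<in> {i, j, k}" "b \<in> {i, j, k}" "a \<noteq> b"
        by (auto elim: nsets2_E)
      then show "y e = 1" using that by (auto simp: closed_tuples_def R_def)
    qed
    then have "of_bool ([i, j, k] \<in> closed_tuples 3 m R) \<le> (\<Prod>e\<in>[{i, j, k}]\<^bsup>2\<^esup>. y e)"
      using Tnn[OF ijk] by (cases "[i, j, k] \<in> closed_tuples 3 m R") auto
    then show "of_bool (case t of (i, j, k) \<Rightarrow> [i, j, k] \<in> closed_tuples 3 m R)
        \<le> (case t of (i, j, k) \<Rightarrow> \<Prod>e\<in>[{i, j, k}]\<^bsup>2\<^esup>. y e)"
      unfolding t by simp
  qed
  also have "\<dots> = T y" unfolding T_def by (simp add: sum.cartesian_product)
  finally have W: "real (card (closed_tuples 3 m R)) \<le> T y" .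
  have "0 \<le> I y" unfolding I_def using Inn by (intro sum_nonneg) auto
  then have "c * T y < 1" using Fy by simp
  then have "c * real (card (closed_tuples 3 m R)) < 1"
    using mult_left_mono[OF W c] by linarith
  then have "real (card (closed_tuples 3 m R)) * real r ^ 2 < real m ^ 3"
    using m by (simp add: c_def field_simps)
  then have "real (card (closed_tuples 3 m R) * r ^ 2) < real (m ^ 3)" by simp
  then have "card (closed_tuples 3 m R) * r ^ 2 < m ^ 3" unfolding of_nat_less_iff .
  then show ?thesis using sym alpha by blast
qed

section \<open>Exponential estimates and numerical verification for k = 3\<close>

text \<open>All terms of the exponential series are nonnegative. Initial segments give numerical
  lower bounds, and the single term with index \<open>s\<close> at x = s gives s^s / s! \<le>
  e^s.\<close>

lemma sum_le_exp:
  fixes x :: real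
  assumes "finite I" "0 \<le> x"
  shows "(\<Sum>i\<in>I. x ^ i / fact i) \<le> exp x"
proof -
  have "(\<Sum>i\<in>I. x ^ i /\<^sub>R fact i) \<le> (\<Sum>i. x ^ i /\<^sub>R fact i)"
    using assms by (intro sum_le_suminf summable_exp_generic) auto
  then show ?thesis by (simp add: exp_def divide_inverse mult.commute)
qed

text \<open>The left side is the product of m - i over i < s, each factor is at most m exp(-i/m),
  and the exponents i add up to \<open>s choose 2\<close>. Bounding it by m^s alone would be too
  weak: for the final constants the extra factor is about exp(-13.1), without which the exponent
  would be positive.\<close>

lemma binomial_times_fact_le:
  assumes "0 < m"
  shows "real (m choose s) * fact s \<le> real m ^ s * exp (- real (s choose 2) / real m)"
proof (induction s)
  case (Suc s)
  have "real (Suc s * (m choose Suc s)) = real ((m - s) * (m choose s))"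
    by (simp only: diff_times_binomial)
  then have "real (Suc s) * real (m choose Suc s) = real (m - s) * real (m choose s)"
    by (simp only: of_nat_mult)
  then have "real (m choose Suc s) * fact (Suc s) = real (m - s) * (real (m choose s) * fact s)"
    by (simp only: fact_Suc mult_ac)
  also have "\<dots> \<le> (real m * exp (- real s / real m)) * (real m ^ s * exp (- real (s choose 2) / real m))"
  proof (rule mult_mono[OF _ Suc])
    show "real (m - s) \<le> real m * exp (- real s / real m)"
    proof (cases "s \<le> m")
      case True
      have "real (m - s) = real m * (1 + - real s / real m)"
        using True assms by (simp add: field_simps)
      also have "\<dots> \<le> real m * exp (- real s / real m)"
        by (intro mult_left_mono exp_ge_add_one_self) simp
      finally show ?thesis .
    qed simp
  qed auto
  also have "\<dots> = real m ^ Suc s * exp (- real s / real m + - real (s choose 2) / real m)"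
    by (simp only: exp_add power_Suc mult_ac)
  also have "- real s / real m + - real (s choose 2) / real m = - real (Suc s choose 2) / real m"
    by (simp add: numeral_2_eq_2 add_divide_distrib diff_divide_distrib)
  finally show ?case .
qed (simp add: numeral_2_eq_2)

text \<open>Combines the previous bound with s! \<ge> (s/e)^s. Taking the number of vertices as a
  multiple \<open>y * s\<close> makes the powers of \<open>s\<close> cancel, leaving (y
  e)^s.\<close>

lemma expected_indep_sets_le:
  fixes p t u :: real and y s :: nat
  assumes "0 < s" "0 < y" "real y \<le> exp u" "0 \<le> 1 - p" "1 - p \<le> exp (- t)"
  shows "real ((y * s) choose s) * (1 - p) ^ (s choose 2)
    \<le> exp (real s * (u + 1) - real (s choose 2) * (1 / real (y * s) + t))"
proof -
  let ?d = "real (s choose 2)" and ?m = "real (y * s)"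
  have fact_ge: "real s ^ s \<le> fact s * exp (real s)"
    using sum_le_exp[of "{s}" "real s"] by (simp add: field_simps)
  have "real ((y * s) choose s) * real s ^ s
      \<le> real ((y * s) choose s) * (fact s * exp (real s))"
    using fact_ge by (intro mult_left_mono) auto
  also have "\<dots> = (real ((y * s) choose s) * fact s) * exp (real s)" by simp
  also have "\<dots> \<le> (?m ^ s * exp (- ?d / ?m)) * exp (real s)"
    using assms by (intro mult_right_mono binomial_times_fact_le) auto
  also have "\<dots> = real s ^ s * (real y ^ s * exp (- ?d / ?m) * exp (real s))"
    by (simp add: power_mult_distrib)
  finally have "real ((y * s) choose s) \<le> real y ^ s * exp (- ?d / ?m) * exp (real s)"
    using assms(1) by (simp add: mult.commute[of _ "real s ^ s"])
  also have "\<dots> \<le> exp u ^ s * exp (- ?d / ?m) * exp (real s)"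
    using assms by (intro mult_right_mono power_mono) auto
  finally have "real ((y * s) choose s) * (1 - p) ^ (s choose 2)
      \<le> (exp u ^ s * exp (- ?d / ?m) * exp (real s)) * exp (- t) ^ (s choose 2)"
    using assms by (intro mult_mono power_mono) auto
  also have "\<dots> = exp (real s * u + - ?d / ?m + real s + ?d * - t)"
    by (simp only: exp_of_nat_mult exp_add)
  also have "real s * u + - ?d / ?m + real s + ?d * - t = real s * (u + 1) - ?d * (1 / ?m + t)"
    by (simp add: algebra_simps)
  finally show ?thesis .
qed

text \<open>The logarithm of 79 is about 4.36945. Dividing the argument by 16 makes five terms of
  the series accurate enough.\<close>

lemma exp_bound_79: "79 \<le> exp (43697 / 10000 :: real)"
proof -
  have "(\<Sum>i<5. (43697 / 160000) ^ i / fact i) \<le> exp (43697 / 160000 :: real)"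
    by (rule sum_le_exp) auto
  moreover have "131402 / 100000 \<le> (\<Sum>i<5. (43697 / 160000 :: real) ^ i / fact i)"
    by (simp add: eval_nat_numeral)
  ultimately have "(131402 / 100000) ^ 16 \<le> exp (43697 / 160000 :: real) ^ 16"
    by (intro power_mono) auto
  also have "\<dots> = exp (43697 / 10000)" by (simp flip: exp_of_nat_mult)
  finally show ?thesis by (simp add: eval_nat_numeral)
qed

text \<open>For p = 0.005165 the value of -ln(1 - p) is about 0.0051784. The bound uses (1 -
  x/64)^64 \<le> exp(-x), with the power written as repeated squaring for evaluation.\<close>

lemma one_minus_le_exp: "1 - 1033 / 200000 \<le> exp (- (5178 / 1000000 :: real))"
proof -
  have pow64: "x ^ 64 = (((((x\<^sup>2)\<^sup>2)\<^sup>2)\<^sup>2)\<^sup>2)\<^sup>2" for x :: real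
    by (simp flip: power_mult)
  have "1 - 1033 / 200000 \<le> (1 - 5178 / 64000000 :: real) ^ 64"
    unfolding pow64 by (simp add: power2_eq_square)
  also have "\<dots> \<le> exp (- (5178 / 1000000 :: real))"
    using exp_ge_one_plus_x_over_n_power_n[of 64 "- (5178 / 1000000)"] by simp
  finally show ?thesis .
qed

lemma first_moment_bound:
  fixes p :: real and m s :: nat
  assumes m: "m = 79 * s" and s: "s = 2074" and p: "p = 1033 / 200000"
  shows "(real m + 3 * p * real m ^ 2 + p ^ 3 * real m ^ 3) * real 2073 ^ 2 / real m ^ 3
      + real (m choose s) * (1 - p) ^ (s choose 2) < 1"
proof -
  have d: "real (s choose 2) = 2149701" by (simp add: s choose_two)
  have "real (m choose s) * (1 - p) ^ (s choose 2)
      \<le> exp (real s * (43697 / 10000 + 1) - real (s choose 2) * (1 / real (79 * s) + 5178 / 1000000))"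
    unfolding m
    by (rule expected_indep_sets_le) (use exp_bound_79 one_minus_le_exp in \<open>auto simp: s p\<close>)
  \<comment> \<open>The exponent is about -7.51.\<close>
  also have "\<dots> \<le> exp (- 7)"
    unfolding d by (simp add: s)
  \<comment> \<open>The closed-triple term is about 0.99868, so 0.0013 just fits beside it; it
    follows from 2.7^7 > 1046.\<close>
  also have "\<dots> \<le> (13 / 10000 :: real)"
  proof -
    have "(\<Sum>i<5. 1 ^ i / fact i) \<le> exp (1 :: real)" by (rule sum_le_exp) auto
    then have "27 / 10 \<le> exp (1 :: real)" by (simp add: eval_nat_numeral)
    then have "(27 / 10) ^ 7 \<le> exp (1 :: real) ^ 7" by (intro power_mono) auto
    also have "\<dots> = exp 7" by (simp flip: exp_of_nat_mult)
    finally have "10000 / 13 \<le> exp (7 :: real)" by (simp add: eval_nat_numeral)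
    then show ?thesis by (simp add: exp_minus field_simps)
  qed
  finally have "real (m choose s) * (1 - p) ^ (s choose 2) \<le> 13 / 10000" .
  moreover have "(real m + 3 * p * real m ^ 2 + p ^ 3 * real m ^ 3) * real 2073 ^ 2 / real m ^ 3
      < 1 - 13 / 10000"
    unfolding m s p by (simp add: power2_eq_square power3_eq_cube)
  ultimately show ?thesis by linarith
qed

text \<open>The random pattern has no independent set of size 2074, so it may replace 2073 cliques:
  the local \<open>s\<close> is the forbidden size, one more than the \<open>s\<close> of the
  blow-up.\<close>

lemma co_turan_beaten_3:
  fixes r :: nat
  assumes "2073 \<le> r"
  shows "\<exists>N. \<forall>n\<ge>N. \<exists>E. fin_sgraph {..<n} E \<and> independence_number {..<n} E \<le> r \<and>
    num_cliques 3 {..<n} E < num_cliques 3 {..<n} (co_turan_edges n r)"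
proof -
  define s m :: nat where "s = 2074" and "m = 79 * s"
  define p :: real where "p = 1033 / 200000"
  have m: "0 < m" by (simp add: m_def s_def)
  have p: "0 \<le> p" "p \<le> 1" by (simp_all add: p_def)
  have "\<exists>R. (\<forall>a b. R a b \<longrightarrow> R b a) \<and>
    (\<forall>S. S \<subseteq> {..<m} \<and> (\<forall>a\<in>S. \<forall>b\<in>S. a \<noteq> b \<longrightarrow> \<not> R a b) \<longrightarrow> card S < s) \<and>
    card (closed_tuples 3 m R) * 2073\<^sup>2 < m ^ 3"
    by (rule exists_pattern_graph[OF p m first_moment_bound[OF m_def s_def p_def]])
  then obtain R where R: "\<forall>a b. R a b \<longrightarrow> R b a"
    "\<forall>S. S \<subseteq> {..<m} \<and> (\<forall>a\<in>S. \<forall>b\<in>S. a \<noteq> b \<longrightarrow> \<not> R a b) \<longrightarrow> card S < s"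
    "card (closed_tuples 3 m R) * 2073\<^sup>2 < m ^ 3"
    by (elim exE conjE)
  have "3 - 1 = (2::nat)" by simp
  then have few: "card (closed_tuples 3 m R) * 2073 ^ (3 - 1) < m ^ 3" using R(3) by (simp only:)
  show ?thesis
  proof (rule blowup_beats_co_turan[where R = R and m = m and s = 2073])
    show "R b a" if "R a b" for a b using R(1) that by blast
    show "card S \<le> 2073" if "S \<subseteq> {..<m}" "\<And>a b. a \<in> S \<Longrightarrow> b \<in> S \<Longrightarrow> a \<noteq> b \<Longrightarrow> \<not> R a b" for S
    proof -
      have "card S < s" using R(2) that by blast
      then show ?thesis by (simp add: s_def)
    qed
  qed (use m assms few in simp_all)
qed

section \<open>Combining the two ranges of k and l\<close>

theorem theorem2p1:
  fixes k l :: nat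
  assumes "(k \<ge> 4 \<and> l \<ge> 3) \<or> (k = 3 \<and> l \<ge> 2074)"
  shows "\<exists>N. \<forall>n\<ge>N.
    (\<exists>(V :: nat set) E. fin_sgraph V E \<and> card V = n \<and> independence_number V E < l \<and>
       num_cliques k V E < num_cliques k {..<n} (co_turan_edges n (l - 1))) \<and>
    min_cliques n k l < num_cliques k {..<n} (co_turan_edges n (l - 1))"
proof -
  define r where "r = l - 1"
  have "\<exists>N. \<forall>n\<ge>N. \<exists>E. fin_sgraph {..<n} E \<and> independence_number {..<n} E \<le> r \<and>
    num_cliques k {..<n} E < num_cliques k {..<n} (co_turan_edges n r)"
    using assms co_turan_beaten_ge_4[of k r] co_turan_beaten_3[of r] by (auto simp: r_def)
  then obtain N where N: "\<And>n. N \<le> n \<Longrightarrow> \<exists>E. fin_sgraph {..<n} E \<and>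
    independence_number {..<n} E \<le> r \<and> num_cliques k {..<n} E < num_cliques k {..<n} (co_turan_edges n r)"
    by blast
  show ?thesis
  proof (intro exI allI impI)
    fix n assume "N \<le> n"
    then obtain E where E: "fin_sgraph {..<n} E" "independence_number {..<n} E \<le> r"
      "num_cliques k {..<n} E < num_cliques k {..<n} (co_turan_edges n r)"
      using N by blast
    \<comment> \<open>Here \<open>l\<close> is positive, so the truncated \<open>l - 1\<close> is
      the true predecessor and a bound by \<open>r\<close> means less than \<open>l\<close>.\<close>
    have alpha: "independence_number {..<n} E < l" using E(2) assms by (auto simp: r_def)
    then have "admissible n l {..<n} E" using E(1) by (simp add: admissible_def)
    then have "min_cliques n k l \<le> num_cliques k {..<n} E"
      unfolding min_cliques_def by (intro cInf_lower) auto
    then show "(\<exists>(V :: nat set) E. fin_sgraph V E \<and> card V = n \<and> independence_number V E < l \<and>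
       num_cliques k V E < num_cliques k {..<n} (co_turan_edges n (l - 1))) \<and>
      min_cliques n k l < num_cliques k {..<n} (co_turan_edges n (l - 1))"
      using E alpha by (auto simp: r_def intro!: exI[of _ "{..<n}"] exI[of _ E])
  qed
qed

end
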